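(* Suppose $G$ is a graph with $n$ vertices and $m$ edges, and let $q\in\mathbb{N}$. If $q\geq 2^m$, then there exists a full $q$-fold cycle-shattering cover $\mathcal{H}$ of $G$. Consequently, if, for each $i$, $a_i$ is the number of acyclic spanning subgraphs of $G$ with exactly $i$ components, then \[ P_{DP}(G,\mathcal{H}) = \sum_{j=0}^{n-1}(-1)^j a_{n-j}\, q^{n-j}. \]
   Context: All graphs are nonempty, finite and simple, and $\mathbb{N}=\{1,2,3,\dots\}$. A spanning subgraph of $G$ is a subgraph with vertex set $V(G)$. For $A\subseteq E(G)$, $G\langle A\rangle$ denotes the spanning subgraph of $G$ with edge set $A$. For a graph $H$ and $S,U\subseteq V(H)$, $E_H(S,U)$ is the set of edges of $H$ with one endpoint in $S$ and the other in $U$. A cover of a graph $G$ is a pair $\mathcal{H}=(L,H)$ where $H$ is a graph and $L$ assigns to each $v\in V(G)$ a set $L(v)\subseteq V(H)$ such that: the sets $L(v)$, $v\in V(G)$, are pairwise disjoint, each $L(v)$ is an independent set in $H$, and $V(H)=\bigcup_{v\in V(G)}L(v)$; and for all distinct $u,v\in V(G)$, $E_H(L(u),L(v))$ is a matching (not necessarily perfect, possibly empty), which is empty whenever $uv\notin E(G)$. The cover is $q$-fold if $|L(v)|=q$ for every $v\in V(G)$. A $q$-fold cover is full if $E_H(L(u),L(v))$ is a perfect matching between $L(u)$ and $L(v)$ for every $uv\in E(G)$. For a $q$-fold cover $\mathcal{H}=(L,H)$ of $G$ and $A\subseteq E(G)$, the subcover $\mathcal{H}\langle A\rangle$ of $G\langle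 A\rangle$ is $(L,H_{\langle A\rangle})$, where $V(H_{\langle A\rangle})=V(H)$ and $E(H_{\langle A\rangle})=\bigcup_{uv\in A}E_H(L(u),L(v))$. A transversal of a cover $\mathcal{H}=(L,H)$ of $G$ is a set $T\subseteq V(H)$ with $|T\cap L(v)|=1$ for every $v\in V(G)$. A proper $\mathcal{H}$-coloring of $G$ is a transversal that is independent in $H$; $P_{DP}(G,\mathcal{H})$ is the number of proper $\mathcal{H}$-colorings of $G$. An anti-$\mathcal{H}$-coloring of $G$ is a transversal $T$ of $\mathcal{H}$ such that the induced subgraph $H[T]$ is isomorphic to $G$; $\mathcal{F}_{\mathcal{H}}$ is the set of all anti-$\mathcal{H}$-colorings of $G$. In particular $\mathcal{F}_{\mathcal{H}\langle A\rangle}$ is the set of transversals $T$ of $\mathcal{H}\langle A\rangle$ with $H_{\langle A\rangle}[T]$ isomorphic to $G\langle A\rangle$. A $q$-fold cover $\mathcal{H}$ of $G$ is cycle-shattering if $|\mathcal{F}_{\mathcal{H}\langle A\rangle}|=0$ for every $A\subseteq E(G)$ such that $G\langle A\rangle$ contains a cycle. *)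

theory Defs
  imports Main "HOL-Library.Disjoint_Sets"
begin

section \<open>Simple graphs\<close>

text \<open>Undirected graphs; edges are two-element sets of vertices.\<close>

record 'a graph =
  verts :: "'a set"
  edges :: "'a set set"

definition simple_graph :: "'a graph \<Rightarrow> bool" where
  "simple_graph G \<longleftrightarrow> finite (verts G) \<and> verts G \<noteq> {} \<and>
     (\<forall>e\<in>edges G. e \<subseteq> verts G \<and> card e = 2)"

definition spanning_subgraph :: "'a graph \<Rightarrow> 'a graph \<Rightarrow> bool" where
  "spanning_subgraph F G \<longleftrightarrow> simple_graph F \<and> verts F = verts G \<and> edges F \<subseteq> edges G"

definition edge_restrict :: "'a graph \<Rightarrow> 'a set set \<Rightarrow> 'a graph"  (\<open>_\<langle>_\<rangle>\<close> [1000, 0] 1000) where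
  "G\<langle>A\<rangle> = \<lparr>verts = verts G, edges = A\<rparr>"

definition induced_subgraph :: "'a graph \<Rightarrow> 'a set \<Rightarrow> 'a graph" where
  "induced_subgraph G S = \<lparr>verts = S, edges = {e \<in> edges G. e \<subseteq> S}\<rparr>"

definition graph_iso :: "'a graph \<Rightarrow> 'b graph \<Rightarrow> bool" where
  "graph_iso G G' \<longleftrightarrow> (\<exists>f. bij_betw f (verts G) (verts G') \<and>
     (\<forall>u\<in>verts G. \<forall>v\<in>verts G. {u, v} \<in> edges G \<longleftrightarrow> {f u, f v} \<in> edges G'))"

definition has_cycle :: "'a graph \<Rightarrow> bool" where
  "has_cycle G \<longleftrightarrow> (\<exists>vs. 3 \<le> length vs \<and> distinct vs \<and> set vs \<subseteq> verts G \<and>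
     (\<forall>i<length vs. {vs ! i, vs ! (Suc i mod length vs)} \<in> edges G))"

definition reachable :: "'a graph \<Rightarrow> ('a \<times> 'a) set" where
  "reachable G = {(u, v). {u, v} \<in> edges G}\<^sup>* \<inter> verts G \<times> verts G"

definition num_components :: "'a graph \<Rightarrow> nat" where
  "num_components G = card (verts G // reachable G)"

definition independent_set :: "'a graph \<Rightarrow> 'a set \<Rightarrow> bool" where
  "independent_set G S \<longleftrightarrow> S \<subseteq> verts G \<and> (\<forall>u\<in>S. \<forall>v\<in>S. {u, v} \<notin> edges G)"

definition edges_between :: "'a graph \<Rightarrow> 'a set \<Rightarrow> 'a set \<Rightarrow> 'a set set" where
  "edges_between G S U = {e \<in> edges G. \<exists>s\<in>S. \<exists>u\<in>U. e = {s, u}}"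

text \<open>A matching is a set of pairwise disjoint edges, which is what
  \<^const>\<open>disjoint\<close> says. For a matching \<open>M\<close> between \<open>S\<close> and \<open>U\<close>, perfect means that every
  vertex of \<open>S\<close> and every vertex of \<open>U\<close> is matched.\<close>

definition perfect_matching_between :: "'a set set \<Rightarrow> 'a set \<Rightarrow> 'a set \<Rightarrow> bool" where
  "perfect_matching_between M S U \<longleftrightarrow>
     disjoint M \<and> (\<forall>e\<in>M. \<exists>s\<in>S. \<exists>u\<in>U. e = {s, u}) \<and> \<Union>M = S \<union> U"


section \<open>Covers\<close>

text \<open>A cover is given by its two components \<open>L\<close> and \<open>H\<close>; the values of \<open>L\<close> outside
  the vertex set of \<open>G\<close> are irrelevant.\<close>

definition cover :: "'a graph \<Rightarrow> ('a \<Rightarrow> 'b set) \<Rightarrow> 'b graph \<Rightarrow> bool" where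
  "cover G L H \<longleftrightarrow> simple_graph H \<and>
     disjoint_family_on L (verts G) \<and>
     (\<forall>v\<in>verts G. independent_set H (L v)) \<and>
     verts H = (\<Union>v\<in>verts G. L v) \<and>
     (\<forall>u\<in>verts G. \<forall>v\<in>verts G. u \<noteq> v \<longrightarrow>
        disjoint (edges_between H (L u) (L v)) \<and>
        ({u, v} \<notin> edges G \<longrightarrow> edges_between H (L u) (L v) = {}))"

definition fold_cover :: "nat \<Rightarrow> 'a graph \<Rightarrow> ('a \<Rightarrow> 'b set) \<Rightarrow> 'b graph \<Rightarrow> bool" where
  "fold_cover q G L H \<longleftrightarrow> cover G L H \<and> (\<forall>v\<in>verts G. card (L v) = q)"

definition full_fold_cover :: "nat \<Rightarrow> 'a graph \<Rightarrow> ('a \<Rightarrow> 'b set) \<Rightarrow> 'b graph \<Rightarrow> bool" where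
  "full_fold_cover q G L H \<longleftrightarrow> fold_cover q G L H \<and>
     (\<forall>u v. {u, v} \<in> edges G \<longrightarrow>
        perfect_matching_between (edges_between H (L u) (L v)) (L u) (L v))"

text \<open>The graph component of the subcover on the edge set \<open>A\<close>; its list component is
  still \<open>L\<close>.\<close>

definition subcover :: "('a \<Rightarrow> 'b set) \<Rightarrow> 'b graph \<Rightarrow> 'a set set \<Rightarrow> 'b graph" where
  "subcover L H A =
     \<lparr>verts = verts H, edges = \<Union>{edges_between H (L u) (L v) | u v. {u, v} \<in> A}\<rparr>"

definition transversal :: "'a graph \<Rightarrow> ('a \<Rightarrow> 'b set) \<Rightarrow> 'b graph \<Rightarrow> 'b set \<Rightarrow> bool" where
  "transversal G L H T \<longleftrightarrow> T \<subseteq> verts H \<and> (\<forall>v\<in>verts G. card (T \<inter> L v) = 1)"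

definition P_DP :: "'a graph \<Rightarrow> ('a \<Rightarrow> 'b set) \<Rightarrow> 'b graph \<Rightarrow> nat" where
  "P_DP G L H = card {T. transversal G L H T \<and> independent_set H T}"

definition anti_colorings :: "'a graph \<Rightarrow> ('a \<Rightarrow> 'b set) \<Rightarrow> 'b graph \<Rightarrow> 'b set set" where
  "anti_colorings G L H = {T. transversal G L H T \<and> graph_iso (induced_subgraph H T) G}"

definition cycle_shattering :: "'a graph \<Rightarrow> ('a \<Rightarrow> 'b set) \<Rightarrow> 'b graph \<Rightarrow> bool" where
  "cycle_shattering G L H \<longleftrightarrow>
     (\<forall>A\<subseteq>edges G. has_cycle (G\<langle>A\<rangle>) \<longrightarrow> card (anti_colorings (G\<langle>A\<rangle>) L (subcover L H A)) = 0)"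

end

theory Submission imports Defs begin

text \<open>
  A transversal of a cover is the image of a section \<open>f\<close>, which picks \<open>f v \<in> L v\<close> for every
  vertex \<open>v\<close>. Such a section lifts an edge \<open>uv\<close> of \<open>G\<close> if \<open>f u\<close> and \<open>f v\<close> are adjacent in \<open>H\<close>. The
  transversal is a proper coloring iff \<open>f\<close> lifts no edge, and it is an anti-coloring of the
  subcover on \<open>A\<close> iff \<open>f\<close> lifts every edge of \<open>A\<close>: the projection to \<open>G\<close> already embeds
  \<open>H\<^bsub>\<langle>A\<rangle>\<^esub>[T]\<close> into \<open>G\<langle>A\<rangle>\<close>, so any isomorphism, which forces equal numbers of edges, makes this
  embedding onto. Hence a cover is cycle-shattering iff the edges lifted by a section always form
  a forest (\<open>cycle_shattering_iff\<close>).

  For the formula, inclusion-exclusion over the set of lifted edges expresses the number of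
  proper colorings as an alternating sum over \<open>A \<subseteq> E(G)\<close> of the number of sections that lift
  \<open>A\<close>. In a cycle-shattering cover that number is zero when \<open>A\<close> contains a cycle. In a full
  \<open>q\<close>-fold cover it is \<open>q ^ c\<close> when \<open>A\<close> is a forest with \<open>c\<close> components, because attaching a leaf to
  a forest leaves the color of the leaf determined by the color of its neighbour
  (\<open>card_lifts_forest\<close>). A forest on \<open>n\<close> vertices with \<open>n - j\<close> components has \<open>j\<close> edges, so grouping
  the forests by their number of edges gives the stated sum.

  For existence, take \<open>{0..<q}\<close> as the list at every vertex, order the vertices, number the
  edges \<open>0, ..., m - 1\<close>, and let the matching along the \<open>i\<close>-th edge be the cyclic shift by \<open>2 ^ i\<close>
  modulo \<open>q\<close> in the direction of the order. If a section lifted all edges of a cycle, the signed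
  sum of the shifts along the cycle would be divisible by \<open>q\<close>. It is a signed sum of distinct
  powers \<open>2 ^ i\<close> with \<open>i < m\<close>, so it is nonzero and smaller than \<open>2 ^ m \<le> q\<close> in absolute value, which
  is impossible.
\<close>

section \<open>Forests\<close>

lemma verts_edge_restrict [simp]: "verts (G\<langle>A\<rangle>) = verts G"
  and edges_edge_restrict [simp]: "edges (G\<langle>A\<rangle>) = A"
  by (simp_all add: edge_restrict_def)

lemma simple_graph_edgeE:
  assumes "simple_graph G" "e \<in> edges G"
  obtains u v where "e = {u, v}" "u \<noteq> v" "u \<in> verts G" "v \<in> verts G"
  using assms unfolding simple_graph_def by (auto simp: card_2_iff dest!: bspec)

lemma edge_endpoints:
  assumes "simple_graph G" "{u, v} \<in> edges G"
  shows "u \<in> verts G" "v \<in> verts G" "u \<noteq> v"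
  using assms by (auto simp: simple_graph_def dest!: bspec)

lemma finite_edges: "simple_graph G \<Longrightarrow> finite (edges G)"
  unfolding simple_graph_def by (metis PowI finite_Pow_iff finite_subset subsetI)

lemma has_cycle_mono: "has_cycle (G\<langle>B\<rangle>) \<Longrightarrow> B \<subseteq> A \<Longrightarrow> has_cycle (G\<langle>A\<rangle>)"
  unfolding has_cycle_def edges_edge_restrict verts_edge_restrict by (meson subsetD)

text \<open>
  The end \<open>v\<close> of a longest path is a leaf: by maximality every neighbour of \<open>v\<close> lies on the path,
  and a neighbour other than the next vertex of the path would close a cycle.
\<close>

lemma forest_has_leaf:
  assumes G: "simple_graph G" and A: "A \<subseteq> edges G" "A \<noteq> {}" and "\<not> has_cycle (G\<langle>A\<rangle>)"
  obtains u v where "{u, v} \<in> A" "u \<noteq> v" "\<forall>e\<in>A. v \<in> e \<longrightarrow> e = {u, v}"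
proof -
  define path where "path vs \<longleftrightarrow> distinct vs \<and> set vs \<subseteq> verts G \<and>
    (\<forall>i. Suc i < length vs \<longrightarrow> {vs ! i, vs ! Suc i} \<in> A)" for vs
  have fin: "finite (verts G)" using G by (simp add: simple_graph_def)
  have bound: "length vs < Suc (card (verts G))" if "path vs" for vs
    using that fin by (metis card_mono distinct_card le_imp_less_Suc path_def)
  obtain a b where ab: "{a, b} \<in> A" "a \<noteq> b" "a \<in> verts G" "b \<in> verts G"
    using A G by (metis simple_graph_edgeE ex_in_conv subsetD)
  have path_ab: "path [a, b]"
    using ab by (auto simp: path_def less_Suc_eq)
  obtain vs where vs: "path vs" and longest: "\<And>ws. path ws \<Longrightarrow> length ws \<le> length vs"
    using ex_has_greatest_nat[of path "[a, b]" length "Suc (card (verts G))"] path_ab bound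
    by blast
  have "length vs \<ge> 2"
    using longest[OF path_ab] by simp
  then obtain v u rest where vs_eq: "vs = v # u # rest"
    by (auto simp: numeral_2_eq_2 Suc_le_length_iff)
  have uv: "{v, u} \<in> A" "v \<noteq> u" "v \<in> verts G"
    using vs by (force simp: path_def vs_eq)+
  show thesis
  proof
    show "\<forall>e\<in>A. v \<in> e \<longrightarrow> e = {u, v}"
    proof (intro ballI impI)
      fix e assume e: "e \<in> A" "v \<in> e"
      have "e \<in> edges G" using e(1) A(1) by blast
      then obtain x where x: "e = {x, v}" "x \<noteq> v" "x \<in> verts G"
        using e(2) by (elim simple_graph_edgeE[OF G]) (auto simp: insert_commute)
      have "x \<in> set vs"
      proof (rule ccontr)
        assume "x \<notin> set vs"
        then have "path (x # vs)"
          using vs x e(1) by (auto simp: path_def nth_Cons vs_eq split: nat.split)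
        then show False using longest by fastforce
      qed
      then obtain k where k: "k < length vs" "x = vs ! k"
        by (metis in_set_conv_nth)
      have "k \<noteq> 0" using k(2) x(2) by (metis nth_Cons_0 vs_eq)
      \<comment> \<open>The initial segment of the path up to \<open>x = vs ! k\<close> is closed by the edge \<open>e\<close>.\<close>
      have "\<not> 2 \<le> k"
      proof
        assume "2 \<le> k"
        define cs where "cs = take (Suc k) vs"
        have len: "length cs = Suc k" and nth: "\<And>i. i \<le> k \<Longrightarrow> cs ! i = vs ! i"
          using k(1) by (simp_all add: cs_def)
        have step: "{vs ! i, vs ! Suc i} \<in> A" if "i < k" for i
          using that k(1) vs by (simp add: path_def)
        have close: "{vs ! k, vs ! 0} \<in> A"
          using e(1) unfolding x(1) k(2) by (simp add: vs_eq)
        have "{cs ! i, cs ! (Suc i mod length cs)} \<in> A" if "i < length cs" for i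
          using that close step[of i] by (cases "i = k") (auto simp: len nth)
        moreover have "distinct cs" "set cs \<subseteq> verts G" "3 \<le> length cs"
          using vs \<open>2 \<le> k\<close> by (auto simp: len) (auto simp: cs_def path_def dest: in_set_takeD)
        ultimately have "has_cycle (G\<langle>A\<rangle>)"
          unfolding has_cycle_def by (intro exI[of _ cs]) auto
        then show False using assms(4) by simp
      qed
      with \<open>k \<noteq> 0\<close> have "k = 1" by simp
      then show "e = {u, v}" using k x by (simp add: vs_eq)
    qed
  qed (use uv in \<open>auto simp: insert_commute\<close>)
qed

text \<open>
  The vertex set stays fixed: the leaf \<open>v\<close> is an isolated vertex of \<open>G\<langle>A\<rangle>\<close> before its edge is
  added.
\<close>

lemma forest_induct [consumes 3, case_names empty attach_leaf]:
  assumes G: "simple_graph G" and "A \<subseteq> edges G" and "\<not> has_cycle (G\<langle>A\<rangle>)"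
    and empty: "P {}"
    and attach: "\<And>A u v. A \<subseteq> edges G \<Longrightarrow> {u, v} \<in> edges G \<Longrightarrow> u \<noteq> v \<Longrightarrow> v \<notin> \<Union>A \<Longrightarrow> P A \<Longrightarrow>
      P (insert {u, v} A)"
  shows "P A"
  using assms(2,3)
proof (induction "card A" arbitrary: A rule: less_induct)
  case (less A)
  show ?case
  proof (cases "A = {}")
    case False
    obtain u v where uv: "{u, v} \<in> A" "u \<noteq> v" and leaf: "\<forall>e\<in>A. v \<in> e \<longrightarrow> e = {u, v}"
      by (rule forest_has_leaf[OF G less.prems(1) False less.prems(2)])
    let ?B = "A - {{u, v}}"
    have "finite A" using finite_edges[OF G] less.prems(1) finite_subset by blast
    then have "card ?B < card A" using uv(1) by (rule card_Diff1_less)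
    moreover have "?B \<subseteq> edges G" "\<not> has_cycle (G\<langle>?B\<rangle>)"
      using less.prems has_cycle_mono[of G ?B A] by auto
    ultimately have PB: "P ?B" by (rule less.hyps)
    have "P (insert {u, v} ?B)"
    proof (intro attach)
      show "v \<notin> \<Union>?B" using leaf by blast
    qed (use less.prems(1) uv PB in auto)
    then show ?thesis using uv(1) by (simp only: insert_Diff)
  qed (simp add: empty)
qed

lemma reachable_class:
  "x \<in> verts G \<Longrightarrow> reachable G `` {x} = {y \<in> verts G. (x, y) \<in> {(u, v). {u, v} \<in> edges G}\<^sup>*}"
  by (auto simp: reachable_def)

text \<open>
  Retracting \<open>v\<close> to \<open>u\<close> maps paths of the larger graph to paths of the smaller one. So adding the
  edge only merges the class \<open>{v}\<close> into the class of \<open>u\<close>; deleting \<open>v\<close> from the new classes gives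
  back the old classes other than \<open>{v}\<close>.
\<close>

lemma num_components_attach_leaf:
  assumes fin: "finite (verts G)" and uv: "u \<in> verts G" "v \<in> verts G" "u \<noteq> v" and leaf: "v \<notin> \<Union>A"
  shows "num_components (G\<langle>A\<rangle>) = Suc (num_components (G\<langle>insert {u, v} A\<rangle>))"
proof -
  let ?V = "verts G" and ?R = "reachable (G\<langle>A\<rangle>)" and ?S = "reachable (G\<langle>insert {u, v} A\<rangle>)"
  define r where "r = {(x, y). {x, y} \<in> A}"
  define s where "s = {(x, y). {x, y} \<in> insert {u, v} A}"
  define \<rho> where "\<rho> = (\<lambda>x. if x = v then u else x)"
  have R: "?R `` {x} = {y \<in> ?V. (x, y) \<in> r\<^sup>*}" if "x \<in> ?V" for x
    using that by (simp add: reachable_class r_def)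
  have S: "?S `` {x} = {y \<in> ?V. (x, y) \<in> s\<^sup>*}" if "x \<in> ?V" for x
    using that by (simp add: reachable_class s_def)
  have "r \<subseteq> s" by (auto simp: r_def s_def)
  then have rs: "r\<^sup>* \<subseteq> s\<^sup>*" by (rule rtrancl_mono)
  have s_retract: "(\<rho> x, \<rho> y) \<in> r\<^sup>*" if "(x, y) \<in> s\<^sup>*" for x y
    using that
  proof (induction rule: rtrancl_induct)
    case (step y z)
    have "(\<rho> y, \<rho> z) \<in> r\<^sup>*"
    proof (cases "{y, z} = {u, v}")
      case True
      then show ?thesis by (auto simp: doubleton_eq_iff \<rho>_def)
    next
      case False
      then have "{y, z} \<in> A" using step.hyps by (simp add: s_def)
      moreover have "y \<noteq> v" "z \<noteq> v" using calculation leaf by auto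
      ultimately show ?thesis by (auto simp: r_def \<rho>_def)
    qed
    then show ?case using step.IH by simp
  qed simp
  have v_alone: "x = v" if "(x, v) \<in> r\<^sup>*" for x
    using that leaf by (cases rule: rtranclE) (auto simp: r_def)
  have v_alone': "x = v" if "(v, x) \<in> r\<^sup>*" for x
    using that leaf by (cases rule: converse_rtranclE) (auto simp: r_def)
  have agree: "(x, y) \<in> r\<^sup>* \<longleftrightarrow> (x, y) \<in> s\<^sup>*" if "x \<noteq> v" "y \<noteq> v" for x y
    using s_retract[of x y] rs that by (auto simp: \<rho>_def)
  have uv_s: "(u, v) \<in> s" "(v, u) \<in> s" by (auto simp: s_def insert_commute)
  have "?S `` {u} = ?S `` {v}"
    using S uv uv_s by (auto intro: converse_rtrancl_into_rtrancl)
  let ?W = "?V - {v}"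
  let ?C = "(\<lambda>x. ?S `` {x}) ` ?W"
  have V: "?V = insert v ?W" using uv by auto
  have "?V // ?S = (\<lambda>x. ?S `` {x}) ` insert v ?W"
    unfolding quotient_def using V by auto
  also have "\<dots> = ?C"
    using \<open>?S `` {u} = ?S `` {v}\<close> uv by auto
  finally have nS: "?V // ?S = ?C" .
  have "?V // ?R = (\<lambda>x. ?R `` {x}) ` insert v ?W"
    unfolding quotient_def using V by auto
  also have "\<dots> = insert {v} ((\<lambda>x. ?R `` {x}) ` ?W)"
    using R[of v] uv v_alone' by auto
  also have "(\<lambda>x. ?R `` {x}) ` ?W = (\<lambda>D. D - {v}) ` ?C"
  proof -
    have "?R `` {x} = ?S `` {x} - {v}" if "x \<in> ?W" for x
      using that R[of x] S[of x] agree v_alone subsetD[OF rs] by auto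
    then show ?thesis unfolding image_image by (rule image_cong[OF refl])
  qed
  finally have nR: "?V // ?R = insert {v} ((\<lambda>D. D - {v}) ` ?C)" .
  have "inj_on (\<lambda>D. D - {v}) ?C"
  proof (rule inj_onI)
    have sym: "sym (s\<^sup>*)"
      by (rule sym_rtrancl) (auto simp: sym_def s_def insert_commute)
    fix D D' assume "D \<in> ?C" "D' \<in> ?C" and eq: "D - {v} = D' - {v}"
    then obtain x y where x: "x \<in> ?W" "D = ?S `` {x}" and y: "y \<in> ?W" "D' = ?S `` {y}" by auto
    have "x \<in> D'" using eq x S[of x] by auto
    then have "(y, x) \<in> s\<^sup>*" using y S[of y] by auto
    then have "(x, y) \<in> s\<^sup>*" using sym by (auto dest: symD)
    with \<open>(y, x) \<in> s\<^sup>*\<close> show "D = D'"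
      using x y S[of x] S[of y] by (auto intro: rtrancl_trans)
  qed
  moreover have "{v} \<notin> (\<lambda>D. D - {v}) ` ?C" by auto
  ultimately show ?thesis
    using fin by (simp add: num_components_def nS nR card_image)
qed

lemma num_components_no_edges: "num_components (G\<langle>{}\<rangle>) = card (verts G)"
proof -
  have "reachable (G\<langle>{}\<rangle>) = Id_on (verts G)"
    by (auto simp: reachable_def)
  then have "verts G // reachable (G\<langle>{}\<rangle>) = (\<lambda>x. {x}) ` verts G"
    by (auto simp: quotient_def)
  then show ?thesis
    by (simp add: num_components_def card_image)
qed

lemma forest_card_edges_plus_components:
  assumes G: "simple_graph G" and "A \<subseteq> edges G" and "\<not> has_cycle (G\<langle>A\<rangle>)"
  shows "card A + num_components (G\<langle>A\<rangle>) = card (verts G)"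
  using assms
proof (induction rule: forest_induct)
  case (attach_leaf A u v)
  have "finite A" using attach_leaf finite_edges[OF G] finite_subset by blast
  moreover have "{u, v} \<notin> A" "u \<in> verts G" "v \<in> verts G" "finite (verts G)"
    using attach_leaf G unfolding simple_graph_def by auto
  ultimately show ?case
    using attach_leaf num_components_attach_leaf[of G u v A] by simp
qed (simp add: num_components_no_edges)

section \<open>Transversals as sections\<close>

text \<open>
  Sections are extensional functions, so that each transversal comes from exactly one of them.
\<close>

definition sections :: "'a graph \<Rightarrow> ('a \<Rightarrow> 'b set) \<Rightarrow> ('a \<Rightarrow> 'b) set" where
  "sections G L = PiE (verts G) L"

definition lifted_edges :: "'a graph \<Rightarrow> 'b graph \<Rightarrow> ('a \<Rightarrow> 'b) \<Rightarrow> 'a set set" where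
  "lifted_edges G H f = {e \<in> edges G. f ` e \<in> edges H}"

lemma section_in: "f \<in> sections G L \<Longrightarrow> v \<in> verts G \<Longrightarrow> f v \<in> L v"
  by (auto simp: sections_def)

lemma lists_disjoint:
  assumes "cover G L H" "u \<in> verts G" "v \<in> verts G" "x \<in> L u" "x \<in> L v"
  shows "u = v"
  using assms unfolding cover_def disjoint_family_on_def by blast

lemma section_inj_on: "cover G L H \<Longrightarrow> f \<in> sections G L \<Longrightarrow> inj_on f (verts G)"
  by (rule inj_onI) (metis lists_disjoint section_in)

lemma section_Int_list:
  assumes "cover G L H" "f \<in> sections G L" "v \<in> verts G"
  shows "f ` verts G \<inter> L v = {f v}"
  using assms lists_disjoint[OF assms(1)] section_in[OF assms(2)] by fast

text \<open>
  The section of a transversal \<open>T\<close> sends \<open>v\<close> to the unique element of \<open>T \<inter> L v\<close>; it exhausts \<open>T\<close>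
  because the lists cover \<open>V(H)\<close>.
\<close>

lemma sections_bij_betw_transversals:
  assumes c: "cover G L H"
  shows "bij_betw (\<lambda>f. f ` verts G) (sections G L) {T. transversal G L H T}"
proof (rule bij_betwI')
  fix f g assume fg: "f \<in> sections G L" "g \<in> sections G L"
  show "f ` verts G = g ` verts G \<longleftrightarrow> f = g"
  proof
    assume eq: "f ` verts G = g ` verts G"
    have "f v = g v" if "v \<in> verts G" for v
      using section_Int_list[OF c fg(1) that] section_Int_list[OF c fg(2) that] eq by auto
    then show "f = g"
      using fg by (auto simp: sections_def intro: PiE_ext)
  qed simp
next
  fix f assume f: "f \<in> sections G L"
  then have "f ` verts G \<subseteq> verts H"
    using c by (auto simp: cover_def dest: section_in)
  then show "f ` verts G \<in> {T. transversal G L H T}"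
    using section_Int_list[OF c f] by (simp add: transversal_def)
next
  fix T assume "T \<in> {T. transversal G L H T}"
  then have T: "T \<subseteq> verts H" "\<And>v. v \<in> verts G \<Longrightarrow> \<exists>x. T \<inter> L v = {x}"
    by (auto simp: transversal_def card_1_singleton_iff)
  then obtain t where t: "\<And>v. v \<in> verts G \<Longrightarrow> T \<inter> L v = {t v}"
    by metis
  have "restrict t (verts G) \<in> sections G L"
    using t by (auto simp: sections_def)
  moreover have "T = restrict t (verts G) ` verts G"
  proof
    show "T \<subseteq> restrict t (verts G) ` verts G"
    proof
      fix x assume x: "x \<in> T"
      then obtain v where v: "v \<in> verts G" "x \<in> L v"
        using T c by (auto simp: cover_def)
      then have "x = t v" using t[of v] x by auto
      then show "x \<in> restrict t (verts G) ` verts G" using v by auto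
    qed
  qed (use t in auto)
  ultimately show "\<exists>f\<in>sections G L. T = f ` verts G" by blast
qed

lemma finite_sections: "cover G L H \<Longrightarrow> simple_graph G \<Longrightarrow> finite (sections G L)"
  unfolding sections_def cover_def simple_graph_def
  by (auto intro!: finite_PiE intro: finite_subset)

lemma lift_is_edge:
  assumes G: "simple_graph G" and c: "cover G L H" and f: "f \<in> sections G L"
    and uv: "u \<in> verts G" "v \<in> verts G" and e: "{f u, f v} \<in> edges H"
  shows "{u, v} \<in> edges G"
proof (cases "u = v")
  case True
  then show ?thesis
    using c e by (auto simp: cover_def simple_graph_def)
next
  case False
  have "{f u, f v} \<in> edges_between H (L u) (L v)"
    using e section_in[OF f] uv by (auto simp: edges_between_def)
  then show ?thesis
    using c uv False unfolding cover_def by blast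
qed

lemma independent_section_iff:
  assumes G: "simple_graph G" and c: "cover G L H" and f: "f \<in> sections G L"
  shows "independent_set H (f ` verts G) \<longleftrightarrow> lifted_edges G H f = {}"
proof
  assume ind: "independent_set H (f ` verts G)"
  have "f ` e \<notin> edges H" if e: "e \<in> edges G" for e
  proof -
    obtain u v where "e = {u, v}" "u \<in> verts G" "v \<in> verts G"
      using simple_graph_edgeE[OF G e] by metis
    then show ?thesis using ind by (auto simp: independent_set_def)
  qed
  then show "lifted_edges G H f = {}" by (auto simp: lifted_edges_def)
next
  assume none: "lifted_edges G H f = {}"
  have "{f u, f v} \<notin> edges H" if "u \<in> verts G" "v \<in> verts G" for u v
    using lift_is_edge[OF G c f that] none by (force simp: lifted_edges_def)
  moreover have "f ` verts G \<subseteq> verts H"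
    using c f by (auto simp: cover_def dest: section_in)
  ultimately show "independent_set H (f ` verts G)"
    by (auto simp: independent_set_def)
qed

section \<open>Anti-colorings\<close>

text \<open>
  As the lists are disjoint, the only vertices of the transversal that an edge between \<open>L u\<close> and
  \<open>L v\<close> can join are \<open>f u\<close> and \<open>f v\<close>.
\<close>

lemma induced_subcover_edges:
  assumes G: "simple_graph G" and c: "cover G L H" and f: "f \<in> sections G L" and A: "A \<subseteq> edges G"
  shows "edges (induced_subgraph (subcover L H A) (f ` verts G)) = (`) f ` (A \<inter> lifted_edges G H f)"
    (is "?E = ?F")
proof
  show "?E \<subseteq> ?F"
  proof
    fix d assume "d \<in> ?E"
    then obtain u v s t where uv: "{u, v} \<in> A" and d: "d \<in> edges H" "d = {s, t}" "s \<in> L u" "t \<in> L v"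
      and sub: "d \<subseteq> f ` verts G"
      by (auto simp: induced_subgraph_def subcover_def edges_between_def)
    have V: "u \<in> verts G" "v \<in> verts G" using edge_endpoints[OF G] uv A by blast+
    then have "s = f u" "t = f v"
      using section_Int_list[OF c f] d sub by blast+
    then have "d = f ` {u, v}" using d by simp
    then show "d \<in> ?F"
      using uv A d(1) by (intro image_eqI[of _ _ "{u, v}"]) (auto simp: lifted_edges_def)
  qed
  show "?F \<subseteq> ?E"
  proof
    fix d assume "d \<in> ?F"
    then obtain e where e: "e \<in> A" "d = f ` e" "f ` e \<in> edges H" by (auto simp: lifted_edges_def)
    obtain u v where uv: "e = {u, v}" "u \<in> verts G" "v \<in> verts G"
      using simple_graph_edgeE[OF G] e(1) A by (metis subsetD)
    then have "d \<in> edges_between H (L u) (L v)"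
      using e section_in[OF f] by (auto simp: edges_between_def)
    then show "d \<in> ?E"
      using e uv by (auto simp: induced_subgraph_def subcover_def)
  qed
qed

lemma graph_iso_card_edges:
  assumes iso: "graph_iso G G'" and G: "simple_graph G" and G': "simple_graph G'"
  shows "card (edges G) = card (edges G')"
proof -
  obtain f where f: "bij_betw f (verts G) (verts G')"
    and edge: "\<And>u v. u \<in> verts G \<Longrightarrow> v \<in> verts G \<Longrightarrow> {u, v} \<in> edges G \<longleftrightarrow> {f u, f v} \<in> edges G'"
    using iso by (auto simp: graph_iso_def)
  have "edges G \<subseteq> Pow (verts G)" using G by (auto simp: simple_graph_def)
  then have "inj_on ((`) f) (edges G)"
    using f by (meson bij_betw_def inj_on_image_Pow inj_on_subset)
  moreover have "(`) f ` edges G = edges G'"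
  proof
    show "(`) f ` edges G \<subseteq> edges G'"
    proof (rule image_subsetI)
      fix e assume e: "e \<in> edges G"
      then show "f ` e \<in> edges G'"
        by (rule simple_graph_edgeE[OF G]) (use e edge in auto)
    qed
    show "edges G' \<subseteq> (`) f ` edges G"
    proof
      fix e assume e: "e \<in> edges G'"
      then obtain a b where "e = {a, b}" "a \<in> verts G'" "b \<in> verts G'"
        using simple_graph_edgeE[OF G'] by metis
      moreover from this obtain u v where "a = f u" "b = f v" "u \<in> verts G" "v \<in> verts G"
        using f by (metis bij_betw_imp_surj_on imageE)
      ultimately have "{u, v} \<in> edges G" "e = f ` {u, v}" using edge e by auto
      then show "e \<in> (`) f ` edges G" by blast
    qed
  qed
  ultimately show ?thesis by (metis card_image)
qed

text \<open>
  An arbitrary isomorphism need not respect the projection to \<open>G\<close>, but it shows that the induced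
  subgraph has \<open>card A\<close> edges. These edges are the images of those edges of \<open>A\<close> that are lifted, so
  all of \<open>A\<close> must be lifted. Conversely, the projection itself is then an isomorphism.
\<close>

lemma anti_coloring_iff:
  assumes G: "simple_graph G" and c: "cover G L H" and f: "f \<in> sections G L" and A: "A \<subseteq> edges G"
  shows "f ` verts G \<in> anti_colorings (G\<langle>A\<rangle>) L (subcover L H A) \<longleftrightarrow> A \<subseteq> lifted_edges G H f"
proof -
  let ?I = "induced_subgraph (subcover L H A) (f ` verts G)"
  note edges_I = induced_subcover_edges[OF G c f A]
  have "transversal G L H (f ` verts G)"
    using sections_bij_betw_transversals[OF c] f by (auto simp: bij_betw_def)
  then have "transversal (G\<langle>A\<rangle>) L (subcover L H A) (f ` verts G)"
    by (simp add: transversal_def subcover_def)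
  moreover have "graph_iso ?I (G\<langle>A\<rangle>) \<longleftrightarrow> A \<subseteq> lifted_edges G H f"
  proof
    assume iso: "graph_iso ?I (G\<langle>A\<rangle>)"
    have "simple_graph (G\<langle>A\<rangle>)" using G A by (auto simp: simple_graph_def)
    moreover have "simple_graph ?I"
      using G c by (auto simp: simple_graph_def cover_def induced_subgraph_def subcover_def edges_between_def)
    ultimately have "card ((`) f ` (A \<inter> lifted_edges G H f)) = card A"
      using graph_iso_card_edges[OF iso] edges_I by simp
    moreover have "finite A" using finite_edges[OF G] A finite_subset by blast
    ultimately have "card (A \<inter> lifted_edges G H f) \<ge> card A"
      by (metis card_image_le finite_Int)
    then show "A \<subseteq> lifted_edges G H f"
      using \<open>finite A\<close> by (metis card_seteq inf.cobounded1 inf.orderI)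
  next
    assume lifted: "A \<subseteq> lifted_edges G H f"
    have inj: "inj_on f (verts G)" by (rule section_inj_on[OF c f])
    have "{f u, f v} \<in> edges ?I \<longleftrightarrow> {u, v} \<in> A" if "u \<in> verts G" "v \<in> verts G" for u v
    proof
      assume "{f u, f v} \<in> edges ?I"
      then obtain e where e: "e \<in> A" "f ` {u, v} = f ` e"
        using edges_I by auto
      then have "e \<subseteq> verts G" using A G by (auto simp: simple_graph_def)
      then have "{u, v} = e" using e(2) inj that by (simp only: inj_on_image_eq_iff insert_subset empty_subsetI simp_thms)
      then show "{u, v} \<in> A" using e by simp
    next
      assume "{u, v} \<in> A"
      then have "f ` {u, v} \<in> edges ?I" using edges_I lifted by blast
      then show "{f u, f v} \<in> edges ?I" by simp
    qed
    moreover have "bij_betw (inv_into (verts G) f) (verts ?I) (verts (G\<langle>A\<rangle>))"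
      using inj by (simp add: induced_subgraph_def bij_betw_inv_into inj_on_imp_bij_betw)
    ultimately show "graph_iso ?I (G\<langle>A\<rangle>)"
      using inj unfolding graph_iso_def
      by (intro exI[of _ "inv_into (verts G) f"]) (auto simp: induced_subgraph_def)
  qed
  ultimately show ?thesis by (simp add: anti_colorings_def)
qed

lemma anti_colorings_subcover:
  assumes G: "simple_graph G" and c: "cover G L H" and A: "A \<subseteq> edges G"
  shows "anti_colorings (G\<langle>A\<rangle>) L (subcover L H A) =
    (\<lambda>f. f ` verts G) ` {f \<in> sections G L. A \<subseteq> lifted_edges G H f}"
proof -
  have "T \<in> (\<lambda>f. f ` verts G) ` sections G L"
    if "T \<in> anti_colorings (G\<langle>A\<rangle>) L (subcover L H A)" for T
    using that bij_betw_imp_surj_on[OF sections_bij_betw_transversals[OF c]]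
    by (auto simp: anti_colorings_def transversal_def subcover_def)
  then show ?thesis
    using anti_coloring_iff[OF G c _ A] by blast
qed

text \<open>
  It suffices to test the largest set that a section lifts, because a cycle in a smaller set of
  lifted edges is also a cycle there.
\<close>

lemma cycle_shattering_iff:
  assumes G: "simple_graph G" and c: "cover G L H"
  shows "cycle_shattering G L H \<longleftrightarrow>
    (\<forall>f\<in>sections G L. \<not> has_cycle (G\<langle>lifted_edges G H f\<rangle>))"
proof -
  have "card (anti_colorings (G\<langle>A\<rangle>) L (subcover L H A)) = 0 \<longleftrightarrow>
      (\<forall>f\<in>sections G L. \<not> A \<subseteq> lifted_edges G H f)" if "A \<subseteq> edges G" for A
    using finite_sections[OF c G] by (auto simp: anti_colorings_subcover[OF G c that])
  then have "cycle_shattering G L H \<longleftrightarrow> (\<forall>A\<subseteq>edges G. has_cycle (G\<langle>A\<rangle>) \<longrightarrow>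
      (\<forall>f\<in>sections G L. \<not> A \<subseteq> lifted_edges G H f))"
    unfolding cycle_shattering_def by simp
  also have "\<dots> \<longleftrightarrow> (\<forall>f\<in>sections G L. \<not> has_cycle (G\<langle>lifted_edges G H f\<rangle>))"
  proof (intro iffI ballI allI impI notI)
    fix f assume *: "\<forall>A\<subseteq>edges G. has_cycle (G\<langle>A\<rangle>) \<longrightarrow>
      (\<forall>f\<in>sections G L. \<not> A \<subseteq> lifted_edges G H f)" "f \<in> sections G L"
      "has_cycle (G\<langle>lifted_edges G H f\<rangle>)"
    have "lifted_edges G H f \<subseteq> edges G" by (auto simp: lifted_edges_def)
    with * show False by blast
  next
    fix A f assume *: "\<forall>f\<in>sections G L. \<not> has_cycle (G\<langle>lifted_edges G H f\<rangle>)"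
      "has_cycle (G\<langle>A\<rangle>)" "f \<in> sections G L" "A \<subseteq> lifted_edges G H f"
    show False using has_cycle_mono[OF *(2,4)] *(1,3) by blast
  qed
  finally show ?thesis .
qed

section \<open>Counting proper colorings\<close>

definition lifts :: "'a graph \<Rightarrow> ('a \<Rightarrow> 'b set) \<Rightarrow> 'b graph \<Rightarrow> 'a set set \<Rightarrow> ('a \<Rightarrow> 'b) set" where
  "lifts G L H A = {f \<in> sections G L. A \<subseteq> lifted_edges G H f}"

lemma P_DP_eq_card_sections:
  assumes G: "simple_graph G" and c: "cover G L H"
  shows "P_DP G L H = card {f \<in> sections G L. lifted_edges G H f = {}}"
proof -
  note bij = sections_bij_betw_transversals[OF c]
  have "{T. transversal G L H T \<and> independent_set H T} =
      {T \<in> (\<lambda>f. f ` verts G) ` sections G L. independent_set H T}"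
    unfolding bij_betw_imp_surj_on[OF bij] by simp
  also have "\<dots> = (\<lambda>f. f ` verts G) ` {f \<in> sections G L. independent_set H (f ` verts G)}"
    by (rule Compr_image_eq)
  also have "{f \<in> sections G L. independent_set H (f ` verts G)} =
      {f \<in> sections G L. lifted_edges G H f = {}}"
    by (rule Collect_cong) (use independent_section_iff[OF G c] in auto)
  finally have "{T. transversal G L H T \<and> independent_set H T} =
      (\<lambda>f. f ` verts G) ` {f \<in> sections G L. lifted_edges G H f = {}}" .
  moreover have "inj_on (\<lambda>f. f ` verts G) {f \<in> sections G L. lifted_edges G H f = {}}"
    using bij_betw_imp_inj_on[OF bij] by (rule inj_on_subset) auto
  ultimately show ?thesis by (simp add: P_DP_def card_image)
qed

lemma sum_alternating_Pow:
  assumes "finite X"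
  shows "(\<Sum>A\<in>Pow X. (-1) ^ card A) = (if X = {} then 1 else 0 :: int)"
  using prod_diff_conv_sum[OF assms, of "\<lambda>_. 1 :: int" "\<lambda>_. 1"] assms
  by (simp add: power_0_left)

text \<open>
  Replace the indicator of "\<open>f\<close> lifts no edge" by the alternating sum over the subsets of the
  lifted edges, and exchange the two sums.
\<close>

lemma P_DP_inclusion_exclusion:
  assumes G: "simple_graph G" and c: "cover G L H"
  shows "int (P_DP G L H) = (\<Sum>A\<in>Pow (edges G). (-1) ^ card A * int (card (lifts G L H A)))"
proof -
  let ?S = "sections G L"
  have finE: "finite (edges G)" by (rule finite_edges[OF G])
  have finS: "finite ?S" by (rule finite_sections[OF c G])
  have X: "lifted_edges G H f \<subseteq> edges G" for f by (auto simp: lifted_edges_def)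
  have "int (P_DP G L H) = (\<Sum>f\<in>?S. if lifted_edges G H f = {} then 1 else 0)"
    using finS by (simp add: P_DP_eq_card_sections[OF G c] sum.If_cases Int_def)
  also have "\<dots> = (\<Sum>f\<in>?S. \<Sum>A\<in>Pow (lifted_edges G H f). (-1) ^ card A)"
    using X finE by (intro sum.cong refl sum_alternating_Pow[symmetric]) (auto intro: finite_subset)
  also have "\<dots> = (\<Sum>f\<in>?S. \<Sum>A\<in>Pow (edges G). if A \<subseteq> lifted_edges G H f then (-1) ^ card A else 0)"
  proof (rule sum.cong[OF refl])
    fix f
    have "Pow (edges G) \<inter> {A. A \<subseteq> lifted_edges G H f} = Pow (lifted_edges G H f)" using X by blast
    then show "(\<Sum>A\<in>Pow (lifted_edges G H f). (-1) ^ card A) =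
        (\<Sum>A\<in>Pow (edges G). if A \<subseteq> lifted_edges G H f then (-1) ^ card A else (0::int))"
      using finE by (simp add: sum.If_cases)
  qed
  also have "\<dots> = (\<Sum>A\<in>Pow (edges G). \<Sum>f\<in>?S. if A \<subseteq> lifted_edges G H f then (-1) ^ card A else 0)"
    by (rule sum.swap)
  also have "\<dots> = (\<Sum>A\<in>Pow (edges G). (-1) ^ card A * int (card (lifts G L H A)))"
    using finS by (intro sum.cong refl) (simp add: sum.If_cases lifts_def Int_def mult.commute)
  finally show ?thesis .
qed

lemma matching_unique:
  assumes "disjoint M" "{x, y} \<in> M" "{x, z} \<in> M"
  shows "y = z"
proof (rule ccontr)
  assume "y \<noteq> z"
  then have "{x, y} \<noteq> {x, z}" by (simp add: doubleton_eq_iff)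
  then show False using disjointD[OF assms] by blast
qed

lemma full_cover_ex1_neighbour:
  assumes G: "simple_graph G" and full: "full_fold_cover q G L H"
    and uv: "{u, v} \<in> edges G" and x: "x \<in> L u"
  shows "\<exists>!y. y \<in> L v \<and> {x, y} \<in> edges H"
proof -
  let ?M = "edges_between H (L u) (L v)"
  have c: "cover G L H" and pm: "perfect_matching_between ?M (L u) (L v)"
    using full uv by (auto simp: full_fold_cover_def fold_cover_def)
  have V: "u \<in> verts G" "v \<in> verts G" "u \<noteq> v"
    using edge_endpoints[OF G uv] by auto
  have "x \<notin> L v" using lists_disjoint[OF c V(1,2) x] V(3) by blast
  obtain e where e: "e \<in> ?M" "x \<in> e" using pm x by (auto simp: perfect_matching_between_def)
  then obtain s y where "e = {s, y}" "s \<in> L u" "y \<in> L v" "e \<in> edges H" by (auto simp: edges_between_def)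
  then have y: "y \<in> L v" "{x, y} \<in> edges H" using e(2) \<open>x \<notin> L v\<close> by auto
  have in_M: "{x, z} \<in> ?M" if "z \<in> L v" "{x, z} \<in> edges H" for z
    using that x unfolding edges_between_def by blast
  have "disjoint ?M" using pm by (simp only: perfect_matching_between_def)
  show ?thesis
  proof (rule ex1I[of _ y])
    show "y \<in> L v \<and> {x, y} \<in> edges H" using y by simp
    fix z assume "z \<in> L v \<and> {x, z} \<in> edges H"
    then show "z = y"
      using matching_unique[OF \<open>disjoint ?M\<close> in_M[of z] in_M[OF y]] by simp
  qed
qed

text \<open>
  A section that lifts \<open>A\<close> has an arbitrary value at \<open>v\<close>. Changing this value to the partner of
  \<open>f u\<close> in \<open>L v\<close> gives a section that also lifts \<open>{u, v}\<close>, and the old value, one of \<open>q\<close>, can be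
  prescribed freely.
\<close>

lemma card_lifts_attach_leaf:
  assumes G: "simple_graph G" and full: "full_fold_cover q G L H" and A: "A \<subseteq> edges G"
    and uv: "{u, v} \<in> edges G" and leaf: "v \<notin> \<Union>A"
  shows "card (lifts G L H A) = card (lifts G L H (insert {u, v} A)) * q"
proof -
  let ?B = "insert {u, v} A"
  have V: "u \<in> verts G" "v \<in> verts G" "u \<noteq> v"
    using edge_endpoints[OF G uv] by auto
  have q: "card (L v) = q" using full V by (auto simp: full_fold_cover_def fold_cover_def)
  have lifts_iff: "f \<in> lifts G L H C \<longleftrightarrow> f \<in> sections G L \<and> (\<forall>e\<in>C. f ` e \<in> edges H)"
    if "C \<subseteq> edges G" for f C
    using that by (auto simp: lifts_def lifted_edges_def)
  note in_A = lifts_iff[OF A] and in_B = lifts_iff[of ?B, OF insert_subsetI[OF uv A]]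
  have upd_section: "f(v := x) \<in> sections G L" if "f \<in> sections G L" "x \<in> L v" for f x
    using that V PiE_fun_upd[of x L v f "verts G"] by (simp add: sections_def insert_absorb)
  have upd_edges: "(\<forall>e\<in>A. f(v := x) ` e \<in> edges H) \<longleftrightarrow> (\<forall>e\<in>A. f ` e \<in> edges H)" for f x
  proof (rule ball_cong[OF refl])
    fix e assume "e \<in> A"
    then have "f(v := x) ` e = f ` e" using leaf by (intro image_cong) auto
    then show "f(v := x) ` e \<in> edges H \<longleftrightarrow> f ` e \<in> edges H" by (simp only:)
  qed
  have "bij_betw (\<lambda>(f, x). f(v := x)) (lifts G L H ?B \<times> L v) (lifts G L H A)"
  proof (rule bij_betwI')
    fix p p' assume "p \<in> lifts G L H ?B \<times> L v" "p' \<in> lifts G L H ?B \<times> L v"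
    then obtain f x g y where p: "p = (f, x)" "p' = (g, y)"
      and f: "f \<in> sections G L" "{f u, f v} \<in> edges H" and g: "g \<in> sections G L" "{g u, g v} \<in> edges H"
      using in_B by fastforce
    have "p = p'" if eq: "f(v := x) = g(v := y)"
    proof -
      have off: "f w = g w" if "w \<noteq> v" for w using fun_cong[OF eq, of w] that by simp
      have "f u \<in> L u" "f v \<in> L v" "g v \<in> L v" "f u = g u"
        using section_in f g V off by auto
      then have "f v = g v"
        using full_cover_ex1_neighbour[OF G full uv, of "f u"] f g by auto
      then have "f = g" using off by (metis ext)
      moreover have "x = y" using fun_cong[OF eq, of v] by simp
      ultimately show ?thesis by (simp add: p)
    qed
    then show "(case p of (f, x) \<Rightarrow> f(v := x)) = (case p' of (f, x) \<Rightarrow> f(v := x)) \<longleftrightarrow> p = p'"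
      by (auto simp: p)
  next
    fix p assume "p \<in> lifts G L H ?B \<times> L v"
    then obtain f x where p: "p = (f, x)" "f \<in> lifts G L H ?B" "x \<in> L v" by blast
    show "(case p of (f, x) \<Rightarrow> f(v := x)) \<in> lifts G L H A"
      unfolding p(1) prod.case in_A upd_edges using p(2,3) in_B upd_section by simp
  next
    \<comment> \<open>The preimage keeps the old value \<open>g v\<close> and moves \<open>v\<close> to the partner \<open>y\<close> of \<open>g u\<close>.\<close>
    fix g assume g: "g \<in> lifts G L H A"
    then have gs: "g \<in> sections G L" using in_A by simp
    obtain y where y: "y \<in> L v" "{g u, y} \<in> edges H"
      using full_cover_ex1_neighbour[OF G full uv] section_in[OF gs V(1)] by blast
    have "g(v := y) ` {u, v} \<in> edges H" using y(2) V(3) by simp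
    then have "g(v := y) \<in> lifts G L H ?B"
      unfolding in_B ball_simps upd_edges using g y(1) in_A upd_section[OF gs] by simp
    then show "\<exists>p\<in>lifts G L H ?B \<times> L v. g = (case p of (f, x) \<Rightarrow> f(v := x))"
      using section_in[OF gs V(2)] by (intro bexI[of _ "(g(v := y), g v)"]) auto
  qed
  then show ?thesis
    using bij_betw_same_card by (metis card_cartesian_product q)
qed

lemma card_lifts_forest:
  assumes G: "simple_graph G" and full: "full_fold_cover q G L H" and "q \<ge> 1"
    and A: "A \<subseteq> edges G" "\<not> has_cycle (G\<langle>A\<rangle>)"
  shows "card (lifts G L H A) = q ^ num_components (G\<langle>A\<rangle>)"
  using G A
proof (induction rule: forest_induct)
  case empty
  have "lifts G L H {} = PiE (verts G) L" by (simp add: lifts_def sections_def)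
  moreover have "(\<Prod>v\<in>verts G. card (L v)) = q ^ card (verts G)"
    using full by (simp add: full_fold_cover_def fold_cover_def)
  ultimately show ?case
    using G by (simp add: card_PiE simple_graph_def num_components_no_edges)
next
  case (attach_leaf A u v)
  have "u \<in> verts G" "v \<in> verts G" "finite (verts G)"
    using attach_leaf G unfolding simple_graph_def by auto
  then have "q * card (lifts G L H (insert {u, v} A)) = q * q ^ num_components (G\<langle>insert {u, v} A\<rangle>)"
    using attach_leaf num_components_attach_leaf[of G u v A]
      card_lifts_attach_leaf[OF G full attach_leaf(1,2,4)]
    by (simp add: mult.commute)
  then show ?case using \<open>q \<ge> 1\<close> by simp
qed

lemma card_forests:
  assumes "simple_graph G"
  shows "card {F. spanning_subgraph F G \<and> \<not> has_cycle F \<and> num_components F = i} =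
    card {A. A \<subseteq> edges G \<and> \<not> has_cycle (G\<langle>A\<rangle>) \<and> num_components (G\<langle>A\<rangle>) = i}"
proof -
  have F: "F = G\<langle>edges F\<rangle>" if "spanning_subgraph F G" for F
    using that by (simp add: spanning_subgraph_def edge_restrict_def)
  have span: "spanning_subgraph (G\<langle>A\<rangle>) G \<longleftrightarrow> A \<subseteq> edges G" for A
    using assms by (auto simp: spanning_subgraph_def simple_graph_def)
  have "{F. spanning_subgraph F G \<and> \<not> has_cycle F \<and> num_components F = i} =
      (\<lambda>A. G\<langle>A\<rangle>) ` {A. A \<subseteq> edges G \<and> \<not> has_cycle (G\<langle>A\<rangle>) \<and> num_components (G\<langle>A\<rangle>) = i}"
    (is "?L = ?R")
  proof
    show "?L \<subseteq> ?R"
    proof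
      fix F assume "F \<in> ?L"
      then show "F \<in> ?R"
        using F[of F] span[of "edges F"] by (intro image_eqI[of _ _ "edges F"]) auto
    qed
  qed (use span in auto)
  moreover have "inj_on (\<lambda>A. G\<langle>A\<rangle>) X" for X
    by (rule inj_onI) (metis edges_edge_restrict)
  ultimately show ?thesis by (simp add: card_image)
qed

theorem P_DP_cycle_shattering:
  assumes G: "simple_graph G" and full: "full_fold_cover q G L H" and "q \<ge> 1"
    and shatter: "cycle_shattering G L H"
    and n: "card (verts G) = n"
    and a: "\<And>i. a i = card {F. spanning_subgraph F G \<and> \<not> has_cycle F \<and> num_components F = i}"
  shows "int (P_DP G L H) = (\<Sum>j = 0..n - 1. (-1) ^ j * int (a (n - j)) * int q ^ (n - j))"
proof -
  have c: "cover G L H" using full by (simp add: full_fold_cover_def fold_cover_def)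
  define \<F> where "\<F> = {A. A \<subseteq> edges G \<and> \<not> has_cycle (G\<langle>A\<rangle>)}"
  have fin: "finite (Pow (edges G))" using finite_edges[OF G] by simp
  have "\<F> \<subseteq> Pow (edges G)" by (auto simp: \<F>_def)
  then have fin\<F>: "finite \<F>" using fin by (rule finite_subset)
  have cyclic: "lifts G L H A = {}" if "has_cycle (G\<langle>A\<rangle>)" for A
    using that shatter has_cycle_mono unfolding cycle_shattering_iff[OF G c] lifts_def by blast
  have comps: "card A \<le> n - 1 \<and> num_components (G\<langle>A\<rangle>) = n - card A" if "A \<in> \<F>" for A
  proof -
    have "num_components (G\<langle>A\<rangle>) > 0"
      using G unfolding num_components_def
      by (auto simp: card_gt_0_iff simple_graph_def quotient_def)
    then show ?thesis
      using that forest_card_edges_plus_components[OF G, of A] n by (auto simp: \<F>_def)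
  qed
  have a_eq: "int (a (n - j)) = (\<Sum>A\<in>{A\<in>\<F>. card A = j}. 1)" if "j \<le> n - 1" for j
  proof -
    have "n > 0" using G n by (auto simp: simple_graph_def card_gt_0_iff)
    have "num_components (G\<langle>A\<rangle>) = n - j \<longleftrightarrow> card A = j" if "A \<in> \<F>" for A
      using comps[OF that] \<open>j \<le> n - 1\<close> \<open>n > 0\<close> by linarith
    then have "{A. A \<subseteq> edges G \<and> \<not> has_cycle (G\<langle>A\<rangle>) \<and> num_components (G\<langle>A\<rangle>) = n - j} =
        {A\<in>\<F>. card A = j}"
      by (auto simp: \<F>_def)
    then show ?thesis using a card_forests[OF G] by simp
  qed
  have "int (P_DP G L H) = (\<Sum>A\<in>Pow (edges G). (-1) ^ card A * int (card (lifts G L H A)))"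
    by (rule P_DP_inclusion_exclusion[OF G c])
  also have "\<dots> = (\<Sum>A\<in>\<F>. (-1) ^ card A * int (card (lifts G L H A)))"
    using fin cyclic by (intro sum.mono_neutral_right) (auto simp: \<F>_def)
  also have "\<dots> = (\<Sum>A\<in>\<F>. (-1) ^ card A * int q ^ (n - card A))"
    using comps card_lifts_forest[OF G full \<open>q \<ge> 1\<close>] by (intro sum.cong refl) (auto simp: \<F>_def)
  also have "\<dots> = (\<Sum>j = 0..n - 1. \<Sum>A\<in>{A\<in>\<F>. card A = j}. (-1) ^ card A * int q ^ (n - card A))"
    using comps fin\<F> by (intro sum.group[symmetric]) auto
  also have "\<dots> = (\<Sum>j = 0..n - 1. (-1) ^ j * int (a (n - j)) * int q ^ (n - j))"
    by (intro sum.cong refl) (simp add: a_eq)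
  finally show ?thesis .
qed

section \<open>Voltage covers\<close>

text \<open>
  The derived graph of a voltage assignment: along an edge from \<open>u\<close> to \<open>v\<close> the color changes by
  \<open>w u v\<close> modulo \<open>q\<close>. The integer-valued \<open>w\<close> takes both directions of an edge as arguments; it
  describes an undirected graph when \<open>w v u = - w u v\<close>.
\<close>

definition voltage_edge :: "'a graph \<Rightarrow> nat \<Rightarrow> ('a \<Rightarrow> 'a \<Rightarrow> int) \<Rightarrow> 'a \<times> nat \<Rightarrow> 'a \<times> nat \<Rightarrow> bool" where
  "voltage_edge G q w p r \<longleftrightarrow> {fst p, fst r} \<in> edges G \<and> snd p < q \<and> snd r < q \<and>
     int q dvd int (snd r) - int (snd p) - w (fst p) (fst r)"

definition voltage_graph :: "'a graph \<Rightarrow> nat \<Rightarrow> ('a \<Rightarrow> 'a \<Rightarrow> int) \<Rightarrow> ('a \<times> nat) graph" where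
  "voltage_graph G q w = \<lparr>verts = verts G \<times> {..<q}, edges = {{p, r} | p r. voltage_edge G q w p r}\<rparr>"

definition fiber :: "nat \<Rightarrow> 'a \<Rightarrow> ('a \<times> nat) set" where
  "fiber q v = {v} \<times> {..<q}"

lemma mod_shift_ex1:
  fixes k :: int
  assumes "q \<ge> 1"
  shows "\<exists>!y. y < q \<and> int q dvd int y - k"
proof (rule ex1I)
  let ?y = "nat (k mod int q)"
  have y_eq: "int ?y = k mod int q" using assms by simp
  then have "int ?y < int q" using assms by simp
  moreover have "int q dvd int ?y - k"
    unfolding y_eq by (metis dvd_minus_mod dvd_minus_iff minus_diff_eq)
  ultimately show "?y < q \<and> int q dvd int ?y - k" by (simp only: of_nat_less_iff)
  fix y assume y: "y < q \<and> int q dvd int y - k"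
  then have "int y mod int q = k mod int q" by (simp only: mod_eq_dvd_iff)
  moreover have "int y mod int q = int y" using y by simp
  ultimately have "int y = k mod int q" by (simp only:)
  then show "y = ?y" by (metis nat_int)
qed

context
  fixes G :: "'a graph" and q :: nat and w :: "'a \<Rightarrow> 'a \<Rightarrow> int"
  assumes G: "simple_graph G" and q: "q \<ge> 1" and antisym: "\<And>u v. w v u = - w u v"
begin

lemma voltage_edge_sym: "voltage_edge G q w p r \<longleftrightarrow> voltage_edge G q w r p"
proof -
  have "int (snd p) - int (snd r) - w (fst r) (fst p) = - (int (snd r) - int (snd p) - w (fst p) (fst r))"
    using antisym[of "fst r" "fst p"] by simp
  then have "int q dvd int (snd p) - int (snd r) - w (fst r) (fst p) \<longleftrightarrow>
      int q dvd int (snd r) - int (snd p) - w (fst p) (fst r)"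
    by (simp only: dvd_minus_iff)
  moreover have "{fst p, fst r} = {fst r, fst p}" by (rule insert_commute)
  ultimately show ?thesis
    unfolding voltage_edge_def by (simp only: conj_ac)
qed

lemma voltage_graph_edge_iff: "{p, r} \<in> edges (voltage_graph G q w) \<longleftrightarrow> voltage_edge G q w p r"
proof
  assume "{p, r} \<in> edges (voltage_graph G q w)"
  then obtain p' r' where "{p, r} = {p', r'}" "voltage_edge G q w p' r'"
    unfolding voltage_graph_def by force
  then show "voltage_edge G q w p r"
    using voltage_edge_sym unfolding doubleton_eq_iff by blast
next
  assume "voltage_edge G q w p r"
  then show "{p, r} \<in> edges (voltage_graph G q w)"
    by (auto simp: voltage_graph_def simp del: split_paired_Ex)
qed

lemma voltage_graph_edgeE:
  assumes "e \<in> edges (voltage_graph G q w)"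
  obtains p r where "e = {p, r}" "voltage_edge G q w p r"
  using assms by (auto simp: voltage_graph_def)

lemma voltage_edge_ex1:
  assumes "{u, v} \<in> edges G" "x < q"
  shows "\<exists>!y. voltage_edge G q w (u, x) (v, y)"
proof -
  have "voltage_edge G q w (u, x) (v, y) \<longleftrightarrow> y < q \<and> int q dvd int y - (int x + w u v)" for y
    using assms by (auto simp: voltage_edge_def algebra_simps)
  then show ?thesis using mod_shift_ex1[OF q, of "int x + w u v"] by simp
qed

lemma voltage_edges_between:
  "edges_between (voltage_graph G q w) (fiber q u) (fiber q v) =
    {{(u, x), (v, y)} | x y. voltage_edge G q w (u, x) (v, y)}"
    (is "?M = ?N")
proof
  show "?M \<subseteq> ?N"
  proof
    fix e assume "e \<in> ?M"
    then obtain x y where "e = {(u, x), (v, y)}" "e \<in> edges (voltage_graph G q w)"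
      by (auto simp: edges_between_def fiber_def)
    then show "e \<in> ?N" using voltage_graph_edge_iff by blast
  qed
  show "?N \<subseteq> ?M"
  proof
    fix e assume "e \<in> ?N"
    then obtain x y where e: "e = {(u, x), (v, y)}" and xy: "voltage_edge G q w (u, x) (v, y)" by blast
    then have "(u, x) \<in> fiber q u" "(v, y) \<in> fiber q v"
      by (simp_all add: fiber_def voltage_edge_def)
    moreover have "e \<in> edges (voltage_graph G q w)" using e xy voltage_graph_edge_iff by simp
    ultimately show "e \<in> ?M" using e unfolding edges_between_def by blast
  qed
qed

lemma full_fold_cover_voltage: "full_fold_cover q G (fiber q) (voltage_graph G q w)"
proof -
  let ?H = "voltage_graph G q w"
  have simple: "simple_graph ?H"
    unfolding simple_graph_def
  proof (intro conjI ballI)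
    show "finite (verts ?H)" "verts ?H \<noteq> {}"
      using G q by (auto simp: voltage_graph_def simple_graph_def lessThan_empty_iff)
    fix e assume "e \<in> edges ?H"
    then obtain p r where e: "e = {p, r}" and pr: "voltage_edge G q w p r"
      by (rule voltage_graph_edgeE)
    then have V: "fst p \<in> verts G" "fst r \<in> verts G" "fst p \<noteq> fst r" "snd p < q" "snd r < q"
      using edge_endpoints[OF G] by (auto simp: voltage_edge_def)
    then have "p \<noteq> r" by auto
    then show "card e = 2" by (simp add: e)
    show "e \<subseteq> verts ?H"
      using V by (auto simp: e voltage_graph_def mem_Times_iff)
  qed
  have disj: "disjoint (edges_between ?H (fiber q u) (fiber q v))" if "u \<noteq> v" for u v
  proof -
    have "x = x' \<longleftrightarrow> y = y'"
      if "voltage_edge G q w (u, x) (v, y)" "voltage_edge G q w (u, x') (v, y')" for x y x' y'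
    proof -
      have "{u, v} \<in> edges G" "{v, u} \<in> edges G" "x < q" "y < q"
        using that by (auto simp: voltage_edge_def insert_commute)
      then show ?thesis
        using that voltage_edge_ex1 voltage_edge_sym by metis
    qed
    then show ?thesis
      using \<open>u \<noteq> v\<close> unfolding voltage_edges_between
      by (intro disjointI) auto
  qed
  have none: "edges_between ?H (fiber q u) (fiber q v) = {}" if "u \<noteq> v" "{u, v} \<notin> edges G" for u v
    using that by (simp add: voltage_edges_between voltage_edge_def)
  have indep: "independent_set ?H (fiber q v)" if "v \<in> verts G" for v
    using that edge_endpoints(3)[OF G, of v v]
    by (auto simp: independent_set_def fiber_def voltage_graph_edge_iff voltage_edge_def)
       (simp add: voltage_graph_def)
  have "cover G (fiber q) ?H"
    unfolding cover_def
    using simple disj none indep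
    by (auto simp: disjoint_family_on_def fiber_def voltage_graph_def)
  moreover have "card (fiber q v) = q" for v :: 'a by (simp add: fiber_def)
  moreover have "perfect_matching_between (edges_between ?H (fiber q u) (fiber q v)) (fiber q u) (fiber q v)"
    if uv: "{u, v} \<in> edges G" for u v
  proof -
    have ne: "u \<noteq> v" using edge_endpoints(3)[OF G uv] .
    have "{v, u} \<in> edges G" using uv by (simp add: insert_commute)
    then have left: "\<exists>y. voltage_edge G q w (u, x) (v, y)"
      and right: "\<exists>y. voltage_edge G q w (u, y) (v, x)" if "x < q" for x
      using voltage_edge_ex1[OF uv that] voltage_edge_ex1[of v u x] that voltage_edge_sym by blast+
    have "\<Union>(edges_between ?H (fiber q u) (fiber q v)) = fiber q u \<union> fiber q v" (is "?M = _")
    proof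
      show "?M \<subseteq> fiber q u \<union> fiber q v" by (auto simp: edges_between_def)
      show "fiber q u \<union> fiber q v \<subseteq> ?M"
      proof
        fix p assume "p \<in> fiber q u \<union> fiber q v"
        then consider z where "p = (u, z)" "z < q" | z where "p = (v, z)" "z < q"
          by (auto simp: fiber_def)
        then obtain x y where "voltage_edge G q w (u, x) (v, y)" "p = (u, x) \<or> p = (v, y)"
          by cases (use left right in blast)+
        then show "p \<in> ?M" unfolding voltage_edges_between by blast
      qed
    qed
    then show ?thesis
      using disj[OF ne] by (auto simp: perfect_matching_between_def edges_between_def)
  qed
  ultimately show ?thesis
    by (simp add: full_fold_cover_def fold_cover_def)
qed

text \<open>
  The voltage of each lifted step is the change of color modulo \<open>q\<close>, and along a closed walk the
  changes of color cancel.
\<close>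

lemma voltage_closed_walk:
  assumes f: "f \<in> sections G (fiber q)" and "vs \<noteq> []" and V: "set vs \<subseteq> verts G"
    and walk: "\<And>i. i < length vs \<Longrightarrow>
      {vs ! i, vs ! (Suc i mod length vs)} \<in> lifted_edges G (voltage_graph G q w) f"
  shows "int q dvd (\<Sum>i<length vs. w (vs ! i) (vs ! (Suc i mod length vs)))"
proof -
  let ?k = "length vs"
  define h where "h i = int (snd (f (vs ! i)))" for i
  have fst_f: "fst (f v) = v" if "v \<in> verts G" for v
    using section_in[OF f that] by (auto simp: fiber_def)
  have "int q dvd h (Suc i mod ?k) - h i - w (vs ! i) (vs ! (Suc i mod ?k))" if "i < ?k" for i
  proof -
    have "Suc i mod ?k < ?k" using \<open>vs \<noteq> []\<close> by simp
    then have "vs ! i \<in> verts G" "vs ! (Suc i mod ?k) \<in> verts G"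
      using that V by (meson nth_mem subsetD)+
    then show ?thesis
      using walk[OF that] fst_f
      by (simp add: lifted_edges_def voltage_graph_edge_iff voltage_edge_def h_def)
  qed
  then have "int q dvd (\<Sum>i<?k. h (Suc i mod ?k) - h i - w (vs ! i) (vs ! (Suc i mod ?k)))"
    by (intro dvd_sum) auto
  moreover have "(\<Sum>i<?k. h (Suc i mod ?k)) = (\<Sum>i<?k. h i)"
  proof -
    obtain l where l: "?k = Suc l" using \<open>vs \<noteq> []\<close> by (cases vs) auto
    have "(\<Sum>i<Suc l. h (Suc i mod Suc l)) = (\<Sum>i<l. h (Suc i)) + h 0"
      by (simp add: sum.lessThan_Suc)
    also have "\<dots> = (\<Sum>i<Suc l. h i)" by (simp only: sum.lessThan_Suc_shift)
    finally show ?thesis by (simp only: l)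
  qed
  ultimately show ?thesis by (simp add: sum_subtractf)
qed

end

section \<open>Powers of two as voltages\<close>

lemma abs_signed_sum_powers_less:
  fixes s :: "nat \<Rightarrow> int"
  assumes "I \<subseteq> {..<k}" "\<And>i. i \<in> I \<Longrightarrow> \<bar>s i\<bar> = 1"
  shows "\<bar>\<Sum>i\<in>I. s i * 2 ^ i\<bar> < 2 ^ k"
proof -
  have "\<bar>\<Sum>i\<in>I. s i * 2 ^ i\<bar> \<le> (\<Sum>i\<in>I. \<bar>s i * 2 ^ i\<bar>)" by (rule sum_abs)
  also have "\<dots> = (\<Sum>i\<in>I. 2 ^ i)" using assms by (intro sum.cong) (auto simp: abs_mult)
  also have "\<dots> \<le> (\<Sum>i<k. 2 ^ i)" using assms by (intro sum_mono2) auto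
  also have "\<dots> = 2 ^ k - 1" by (induction k) auto
  finally show ?thesis by simp
qed

text \<open>
  The largest power exceeds the sum of all the smaller ones.
\<close>

lemma signed_sum_powers_nonzero:
  fixes s :: "nat \<Rightarrow> int"
  assumes "finite I" "I \<noteq> {}" "\<And>i. i \<in> I \<Longrightarrow> \<bar>s i\<bar> = 1"
  shows "(\<Sum>i\<in>I. s i * 2 ^ i) \<noteq> 0"
proof
  assume 0: "(\<Sum>i\<in>I. s i * 2 ^ i) = 0"
  let ?k = "Max I"
  have "?k \<in> I" using assms by simp
  then have "(\<Sum>i\<in>I. s i * 2 ^ i) = s ?k * 2 ^ ?k + (\<Sum>i\<in>I - {?k}. s i * 2 ^ i)"
    by (rule sum.remove[OF assms(1)])
  then have "\<bar>\<Sum>i\<in>I - {?k}. s i * 2 ^ i\<bar> = \<bar>s ?k * 2 ^ ?k\<bar>" using 0 by linarith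
  also have "\<dots> = 2 ^ ?k" using assms(3)[OF \<open>?k \<in> I\<close>] by (simp add: abs_mult)
  finally have "\<bar>\<Sum>i\<in>I - {?k}. s i * 2 ^ i\<bar> = 2 ^ ?k" .
  moreover have "I - {?k} \<subseteq> {..<?k}"
    using assms(1) by (auto simp: le_less dest: Max_ge)
  then have "\<bar>\<Sum>i\<in>I - {?k}. s i * 2 ^ i\<bar> < 2 ^ ?k"
    using assms(3) by (intro abs_signed_sum_powers_less) auto
  ultimately show False by simp
qed

text \<open>
  Two different positions on a cycle can carry the same edge only if each is the cyclic successor
  of the other, which needs length \<open>2\<close>.
\<close>

lemma cycle_edges_distinct:
  assumes vs: "distinct vs" "3 \<le> length vs"
  shows "inj_on (\<lambda>i. {vs ! i, vs ! (Suc i mod length vs)}) {..<length vs}"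
proof (rule inj_onI)
  let ?k = "length vs"
  fix i j assume ij: "i \<in> {..<?k}" "j \<in> {..<?k}"
    and eq: "{vs ! i, vs ! (Suc i mod ?k)} = {vs ! j, vs ! (Suc j mod ?k)}"
  have "Suc i mod ?k < ?k" "Suc j mod ?k < ?k" using vs(2) by (auto intro: mod_less_divisor)
  then have "i = j \<or> (i = Suc j mod ?k \<and> Suc i mod ?k = j)"
    using eq ij vs(1) by (auto simp: doubleton_eq_iff nth_eq_iff_index_eq)
  then show "i = j"
    using ij vs(2) by (auto simp: mod_Suc split: if_splits)
qed

text \<open>
  The voltages are \<open>2 ^ i\<close> on the \<open>i\<close>-th edge, signed by an arbitrary order on the vertices. The
  sums of these over subsets of the edges are small enough to survive reduction modulo \<open>q\<close>, so a
  cycle never has total voltage zero.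
\<close>

lemma ex_full_cycle_shattering_cover:
  fixes G :: "'a graph"
  assumes G: "simple_graph G" and q: "q \<ge> 2 ^ card (edges G)"
  shows "\<exists>(L :: 'a \<Rightarrow> ('a \<times> nat) set) H. full_fold_cover q G L H \<and> cycle_shattering G L H"
proof -
  let ?m = "card (edges G)"
  have "(1::nat) \<le> 2 ^ ?m" by simp
  then have q1: "q \<ge> 1" using q by linarith
  obtain idx where idx: "bij_betw idx (edges G) {0..<?m}"
    using ex_bij_betw_finite_nat[OF finite_edges[OF G]] by blast
  have "finite (verts G)" using G by (simp add: simple_graph_def)
  then obtain enc :: "'a \<Rightarrow> nat" where enc: "inj_on enc (verts G)"
    using finite_imp_inj_to_nat_seg by metis
  \<comment> \<open>The value \<open>0\<close> makes \<open>sg\<close> antisymmetric for all arguments; it does not occur on edges.\<close>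
  define sg :: "'a \<Rightarrow> 'a \<Rightarrow> int" where
    "sg u v = (if enc u < enc v then 1 else if enc v < enc u then -1 else 0)" for u v
  define w where "w u v = sg u v * 2 ^ idx {u, v}" for u v
  have antisym: "w v u = - w u v" for u v
    by (simp add: w_def sg_def insert_commute)
  let ?H = "voltage_graph G q w"
  have full: "full_fold_cover q G (fiber q) ?H"
    by (rule full_fold_cover_voltage[OF G q1 antisym])
  then have c: "cover G (fiber q) ?H" by (simp add: full_fold_cover_def fold_cover_def)
  have "cycle_shattering G (fiber q) ?H"
    unfolding cycle_shattering_iff[OF G c]
  proof (intro ballI notI)
    fix f assume f: "f \<in> sections G (fiber q)" and "has_cycle (G\<langle>lifted_edges G ?H f\<rangle>)"
    then obtain vs where vs: "3 \<le> length vs" "distinct vs" "set vs \<subseteq> verts G"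
      and lifted: "\<And>i. i < length vs \<Longrightarrow> {vs ! i, vs ! (Suc i mod length vs)} \<in> lifted_edges G ?H f"
      by (auto simp: has_cycle_def)
    let ?k = "length vs"
    define ed where "ed i = {vs ! i, vs ! (Suc i mod ?k)}" for i
    define t where "t i = sg (vs ! i) (vs ! (Suc i mod ?k))" for i
    have ed: "ed i \<in> edges G" if "i < ?k" for i
      using lifted[OF that] by (auto simp: ed_def lifted_edges_def)
    have inj: "inj_on (idx \<circ> ed) {..<?k}"
    proof (rule comp_inj_on)
      show "inj_on ed {..<?k}"
        using cycle_edges_distinct[OF vs(2,1)] by (simp add: ed_def[abs_def])
      show "inj_on idx (ed ` {..<?k})"
        using bij_betw_imp_inj_on[OF idx] by (rule inj_on_subset) (use ed in auto)
    qed
    \<comment> \<open>Reindexing by edge numbers turns the total voltage into a signed sum over a set of exponents.\<close>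
    let ?I = "(idx \<circ> ed) ` {..<?k}"
    define s where "s n = t (the_inv_into {..<?k} (idx \<circ> ed) n)" for n
    have s: "s ((idx \<circ> ed) i) = t i" if "i < ?k" for i
      using the_inv_into_f_f[OF inj, of i] that by (simp add: s_def)
    have sum_eq: "(\<Sum>i<?k. w (vs ! i) (vs ! (Suc i mod ?k))) = (\<Sum>n\<in>?I. s n * 2 ^ n)"
      unfolding sum.reindex[OF inj] using s by (intro sum.cong) (auto simp: w_def t_def ed_def)
    have sign: "\<bar>s n\<bar> = 1" if n: "n \<in> ?I" for n
    proof -
      obtain i where i: "i < ?k" "n = (idx \<circ> ed) i" using n by blast
      have "enc (vs ! i) \<noteq> enc (vs ! (Suc i mod ?k))"
        using edge_endpoints[OF G] ed[OF i(1)] enc unfolding ed_def by (metis inj_onD)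
      then show ?thesis using s[OF i(1)] by (auto simp: i(2) t_def sg_def)
    qed
    have "?I \<subseteq> {..<?m}" using bij_betwE[OF idx] ed by auto
    then have "\<bar>\<Sum>n\<in>?I. s n * 2 ^ n\<bar> < 2 ^ ?m"
      using sign by (rule abs_signed_sum_powers_less)
    also have "(2::int) ^ ?m \<le> int q" using q by (metis of_nat_le_iff of_nat_numeral of_nat_power)
    finally have small: "\<bar>\<Sum>n\<in>?I. s n * 2 ^ n\<bar> < int q" .
    have "vs \<noteq> []" using vs(1) by auto
    then have "int q dvd (\<Sum>n\<in>?I. s n * 2 ^ n)"
      using voltage_closed_walk[OF G q1 antisym f _ vs(3) lifted] sum_eq by simp
    then have "(\<Sum>n\<in>?I. s n * 2 ^ n) = 0"
      using small by (metis dvd_imp_le_int abs_of_nat not_le)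
    moreover have "(\<Sum>n\<in>?I. s n * 2 ^ n) \<noteq> 0"
      using sign vs(1) by (intro signed_sum_powers_nonzero) (auto simp: lessThan_empty_iff)
    ultimately show False by contradiction
  qed
  with full show ?thesis by blast
qed

theorem lemma11:
  fixes G :: "'a graph" and n m q :: nat and a :: "nat \<Rightarrow> nat"
  assumes "simple_graph G"
    and "card (verts G) = n"
    and "card (edges G) = m"
    and "q \<ge> 1"
    and "q \<ge> 2 ^ m"
    and "\<And>i. a i = card {F. spanning_subgraph F G \<and> \<not> has_cycle F \<and> num_components F = i}"
  shows "(\<exists>(L :: 'a \<Rightarrow> ('a \<times> nat) set) H. full_fold_cover q G L H \<and> cycle_shattering G L H) \<and>
    (\<forall>(L :: 'a \<Rightarrow> 'b set) H. full_fold_cover q G L H \<and> cycle_shattering G L H \<longrightarrow>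
       int (P_DP G L H) = (\<Sum>j = 0..n - 1. (-1) ^ j * int (a (n - j)) * int q ^ (n - j)))"
proof (intro conjI allI impI)
  show "\<exists>(L :: 'a \<Rightarrow> ('a \<times> nat) set) H. full_fold_cover q G L H \<and> cycle_shattering G L H"
    using assms(3,5) by (intro ex_full_cycle_shattering_cover[OF assms(1)]) simp
next
  fix L :: "'a \<Rightarrow> 'b set" and H
  assume "full_fold_cover q G L H \<and> cycle_shattering G L H"
  then show "int (P_DP G L H) = (\<Sum>j = 0..n - 1. (-1) ^ j * int (a (n - j)) * int q ^ (n - j))"
    using P_DP_cycle_shattering[OF assms(1) _ assms(4) _ assms(2,6)] by blast
qed

end
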